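(* Let $I\subset(0,\infty)$ be an interval with interior $I^\circ$, let $f:I\to\mathbb{R}$ be differentiable on $I^\circ$, let $m\in(0,1]$, let $a,b/m\in I^\circ$ with $a<b$, and suppose $f'\in L[a,b]$. Let $\alpha\in[0,1]$ and $q\ge 1$. If $|f'|^q$ is harmonically $(\alpha,m)$-convex on $[a,b/m]$, then $$\left|\frac{f(a)+f(b)}{2}-\frac{ab}{b-a}\int_a^b\frac{f(x)}{x^2}\,dx\right|\le\frac{ab(b-a)}{2^{2-1/q}}\left[\lambda(\alpha,q;a,b)|f'(a)|^q+m\,\mu(\alpha,q;a,b)|f'(b/m)|^q\right]^{1/q},$$ where $$\lambda(\alpha,q;a,b)=\frac{\beta(1,\alpha+2)}{b^{2q}}\,{}_2F_1\left(2q,1;\alpha+3;1-\frac ab\right)-\frac{\beta(2,\alpha+1)}{b^{2q}}\,{}_2F_1\left(2q,2;\alpha+3;1-\frac ab\right)+\frac{2^{2q-\alpha}\beta(2,\alpha+1)}{(a+b)^{2q}}\,{}_2F_1\left(2q,2;\alpha+3;1-\frac{2a}{a+b}\right),$$ $$\mu(\alpha,q;a,b)=\lambda(0,q;a,b)-\lambda(\alpha,q;a,b).$$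
   Context: For $\alpha\in[0,1]$, $m\in(0,1]$ and an interval $J\subset(0,\infty)$, a real function $g$ is harmonically $(\alpha,m)$-convex on $J$ if $$g\left(\frac{mxy}{mty+(1-t)x}\right)\le t^{\alpha}g(x)+m(1-t^{\alpha})g(y)$$ for all $x,y\in J$ and $t\in[0,1]$ such that the point $\frac{mxy}{mty+(1-t)x}=\left(\frac tx+\frac{1-t}{my}\right)^{-1}$ lies in $J$. $\beta(x,y)=\frac{\Gamma(x)\Gamma(y)}{\Gamma(x+y)}=\int_0^1t^{x-1}(1-t)^{y-1}dt$ for $x,y>0$ is the Euler Beta function, and ${}_2F_1(A,B;C;z)=\frac{1}{\beta(B,C-B)}\int_0^1t^{B-1}(1-t)^{C-B-1}(1-zt)^{-A}dt$ for $C>B>0$, $|z|<1$ is the hypergeometric function. $L[a,b]$ denotes the Lebesgue integrable functions on $[a,b]$. *)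

theory Defs
  imports "HOL-Analysis.Analysis"
begin

text \<open>
  The power \<open>t\<close> to the \<open>\<alpha>\<close> for \<open>t \<ge> 0\<close> and \<open>\<alpha> \<ge> 0\<close>, with the usual convention that
  zero to the power zero is one (whereas \<open>0 powr 0 = 0\<close>).
\<close>

definition nn_power :: "real \<Rightarrow> real \<Rightarrow> real" where
  "nn_power t \<alpha> = (if \<alpha> = 0 then 1 else t powr \<alpha>)"

definition harmonically_convex_on :: "real \<Rightarrow> real \<Rightarrow> real set \<Rightarrow> (real \<Rightarrow> real) \<Rightarrow> bool" where
  "harmonically_convex_on \<alpha> m J g \<longleftrightarrow>
     (\<forall>x\<in>J. \<forall>y\<in>J. \<forall>t\<in>{0..1}.
        m * x * y / (m * t * y + (1 - t) * x) \<in> J \<longrightarrow>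
        g (m * x * y / (m * t * y + (1 - t) * x))
          \<le> nn_power t \<alpha> * g x + m * (1 - nn_power t \<alpha>) * g y)"

text \<open>
  Euler's integral, meant for \<open>C > B > 0\<close> and \<open>\<bar>z\<bar> < 1\<close>. The value of \<open>powr\<close> at base zero
  only affects the integrand at the endpoints of the interval, hence not the integral.
\<close>

definition hyp2F1 :: "real \<Rightarrow> real \<Rightarrow> real \<Rightarrow> real \<Rightarrow> real" where
  "hyp2F1 A B C z = 1 / Beta B (C - B) *
     integral {0..1} (\<lambda>t. t powr (B - 1) * (1 - t) powr (C - B - 1) * (1 - z * t) powr (- A))"

definition lam :: "real \<Rightarrow> real \<Rightarrow> real \<Rightarrow> real \<Rightarrow> real" where
  "lam \<alpha> q a b =
     Beta 1 (\<alpha> + 2) / b powr (2 * q) * hyp2F1 (2 * q) 1 (\<alpha> + 3) (1 - a / b)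
     - Beta 2 (\<alpha> + 1) / b powr (2 * q) * hyp2F1 (2 * q) 2 (\<alpha> + 3) (1 - a / b)
     + 2 powr (2 * q - \<alpha>) * Beta 2 (\<alpha> + 1) / (a + b) powr (2 * q)
         * hyp2F1 (2 * q) 2 (\<alpha> + 3) (1 - 2 * a / (a + b))"

definition mu :: "real \<Rightarrow> real \<Rightarrow> real \<Rightarrow> real \<Rightarrow> real" where
  "mu \<alpha> q a b = lam 0 q a b - lam \<alpha> q a b"

end

theory Submission
  imports Defs
begin

text \<open>
  Write \<open>u t = t * b + (1 - t) * a\<close>. The curve \<open>t \<mapsto> a * b / u t\<close> runs from \<open>b\<close> to \<open>a\<close> through
  weighted harmonic means of \<open>a\<close> and \<open>b\<close>, and \<open>d (a * b / u t) = - a * b * (b - a) / (u t)\<^sup>2 dt\<close>.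
  Integrating by parts along this curve turns the trapezoid error into a weighted integral of the
  derivative, \<open>a * b * (b - a) / 2\<close> times the integral over \<open>0 \<le> t \<le> 1\<close> of
  \<open>(1 - 2 * t) * f' (a * b / u t) / (u t)\<^sup>2\<close> (\<open>harmonic_trapezoid_identity\<close>).

  The power mean inequality for the weight \<open>\<bar>1 - 2 * t\<bar>\<close> moves the exponent \<open>q\<close> inside the
  integral. The weight has total mass \<open>1 / 2\<close>, and the resulting factor \<open>(1 / 2) powr (1 - 1 / q)\<close>
  makes the \<open>2\<close> in the identity the \<open>2 powr (2 - 1 / q)\<close> of the bound. Now
  \<open>a * b / u t\<close> is exactly the harmonic combination of \<open>x = a\<close> and \<open>y = b / m\<close>, so
  \<open>\<bar>f'\<bar> powr q\<close> there is at most
  \<open>t powr \<alpha> * \<bar>f' a\<bar> powr q + m * (1 - t powr \<alpha>) * \<bar>f' (b / m)\<bar> powr q\<close>. What is left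
  are the integrals of \<open>\<bar>1 - 2 * t\<bar> * t powr \<alpha> / u t powr (2 * q)\<close>, and \<open>lam_has_integral\<close>
  identifies them with the combination \<open>lam\<close> of hypergeometric functions; subtracting from the
  case \<open>\<alpha> = 0\<close> gives \<open>mu\<close>.

  The power mean inequality is used in the form \<open>weighted_power_mean_le\<close>, whose right-hand side
  integrates a majorant of the \<open>q\<close>-th power. Here the majorant is the explicit continuous
  function that convexity provides.
\<close>

section \<open>A power mean inequality with a majorant\<close>

text \<open>
  For \<open>S > 0\<close> take \<open>K = (S / W) powr (1 / q)\<close>: then \<open>K powr (1 - q) * S = K * W\<close>, so both terms
  together are \<open>K * W\<close>, the bound claimed. For \<open>S = 0\<close> this \<open>K\<close> is \<open>0\<close>, and the bound comes from
  letting \<open>K\<close> tend to \<open>0\<close>.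
\<close>

lemma le_optimal_Young_bound:
  fixes X S W q :: real
  assumes q: "1 \<le> q" and W: "0 < W" and S: "0 \<le> S"
    and le: "\<And>K. 0 < K \<Longrightarrow> X \<le> K powr (1 - q) * S / q + (1 - 1 / q) * K * W"
  shows "X \<le> W powr (1 - 1 / q) * S powr (1 / q)"
proof (cases "S = 0")
  case True
  have "X \<le> 0 + e" if e: "0 < e" for e
  proof -
    have "X \<le> (1 - 1 / q) * (e / W) * W"
      using le[of "e / W"] e W True by simp
    also have "\<dots> = (1 - 1 / q) * e"
      using W by simp
    also have "\<dots> \<le> 1 * e"
      by (rule mult_right_mono) (use q e in auto)
    finally show ?thesis by simp
  qed
  then have "X \<le> 0"
    by (rule field_le_epsilon)
  then show ?thesis using True by simp
next
  case False
  with S have S: "0 < S" by simp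
  define K where "K = (S / W) powr (1 / q)"
  have K: "0 < K"
    using S W by (simp add: K_def)
  have "K powr q = S / W"
    using S W q by (simp add: K_def powr_powr)
  then have "K powr (1 - q) * S = K * W"
    using K S W by (simp add: powr_diff field_simps)
  then have "X \<le> K * W / q + (1 - 1 / q) * K * W"
    using le[OF K] by simp
  also have "\<dots> = K * W"
    using q by (simp add: field_simps)
  also have "K * W = W powr (1 - 1 / q) * S powr (1 / q)"
    using S W by (simp add: K_def powr_divide powr_diff)
  finally show ?thesis .
qed

text \<open>
  Young's inequality bounds \<open>\<bar>g\<bar>\<close> pointwise by a combination of \<open>G\<close> and a constant, with a free
  parameter \<open>K\<close> that is chosen after integration. Only \<open>w\<close> and \<open>w * G\<close> are integrated on
  the larger side, so \<open>\<bar>g\<bar> powr q\<close> itself never enters an integral.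
\<close>

lemma weighted_power_mean_le:
  fixes w g G :: "real \<Rightarrow> real"
  assumes q: "1 \<le> q" and w: "\<And>t. t \<in> T \<Longrightarrow> 0 \<le> w t"
    and G: "\<And>t. t \<in> T \<Longrightarrow> \<bar>g t\<bar> powr q \<le> G t"
    and X: "((\<lambda>t. w t * g t) has_integral X) T"
    and W: "(w has_integral W) T" "0 < W"
    and S: "((\<lambda>t. w t * G t) has_integral S) T"
  shows "\<bar>X\<bar> \<le> W powr (1 - 1 / q) * S powr (1 / q)"
proof (rule le_optimal_Young_bound[OF q W(2)])
  have G0: "0 \<le> G t" if "t \<in> T" for t
    using G[OF that] powr_ge_zero[of "\<bar>g t\<bar>" q] by linarith
  show "0 \<le> S"
    by (rule has_integral_nonneg[OF S]) (use w G0 in auto)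
  fix K :: real assume K: "0 < K"
  have young: "\<bar>g t\<bar> \<le> K powr (1 - q) * G t / q + (1 - 1 / q) * K" if t: "t \<in> T" for t
  proof (cases "g t = 0")
    case True
    then show ?thesis using q K G0[OF t] by simp
  next
    case False
    (* Young's inequality for the numbers \<bar>g t\<bar> powr q * K powr (1 - q) and K, with the
       weights 1 / q and 1 - 1 / q *)
    have "\<bar>g t\<bar> = (\<bar>g t\<bar> powr q * K powr (1 - q)) powr (1 / q) * K powr (1 - 1 / q)"
    proof -
      have "(K powr (1 - q)) powr (1 / q) * K powr (1 - 1 / q) = 1"
        using q K by (simp add: powr_powr flip: powr_add) (simp add: field_simps)
      then show ?thesis
        using q K False by (simp add: powr_mult powr_powr)
    qed
    also have "\<dots> \<le> 1 / q * (\<bar>g t\<bar> powr q * K powr (1 - q)) + (1 - 1 / q) * K"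
      by (rule Youngs_inequality_0) (use q K False in auto)
    also have "\<dots> \<le> 1 / q * (G t * K powr (1 - q)) + (1 - 1 / q) * K"
      using q G[OF t] by (intro add_right_mono mult_left_mono mult_right_mono) auto
    finally show ?thesis by (simp add: mult.commute)
  qed
  have "((\<lambda>t. K powr (1 - q) / q * (w t * G t) + (1 - 1 / q) * K * w t) has_integral
      (K powr (1 - q) / q * S + (1 - 1 / q) * K * W)) T"
    by (intro has_integral_add has_integral_mult_right S W)
  moreover have "norm (w t * g t) \<le> K powr (1 - q) / q * (w t * G t) + (1 - 1 / q) * K * w t"
    if "t \<in> T" for t
    using mult_left_mono[OF young[OF that] w[OF that]] w[OF that]
    by (simp add: abs_mult algebra_simps)
  ultimately have "norm (integral T (\<lambda>t. w t * g t)) \<le> K powr (1 - q) / q * S + (1 - 1 / q) * K * W"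
    using integral_norm_bound_integral X by (metis (no_types, lifting) has_integral_iff)
  then show "\<bar>X\<bar> \<le> K powr (1 - q) * S / q + (1 - 1 / q) * K * W"
    using X by (simp add: has_integral_iff)
qed

section \<open>The trapezoid error as an integral of the derivative\<close>

text \<open>
  The derivative of \<open>(1 / 2 - t) * f (a * b / u t)\<close> has two parts. The fundamental theorem of
  calculus integrates their sum, and the substitution \<open>x = a * b / u t\<close> integrates the part without
  \<open>f'\<close>, which is continuous; the part with \<open>f'\<close> is the difference.
\<close>

lemma harmonic_trapezoid_identity:
  fixes f f' :: "real \<Rightarrow> real"
  assumes a: "0 < a" and ab: "a < b"
    and f: "\<And>x. x \<in> {a..b} \<Longrightarrow> (f has_real_derivative f' x) (at x)"
  shows "((\<lambda>t. a * b * (b - a) / 2 *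
            ((1 - 2 * t) * (f' (a * b / (t * b + (1 - t) * a)) / (t * b + (1 - t) * a)\<^sup>2)))
          has_integral ((f a + f b) / 2 - a * b / (b - a) * integral {a..b} (\<lambda>x. f x / x\<^sup>2))) {0..1}"
proof -
  define u where "u = (\<lambda>t. t * b + (1 - t) * a)"
  have u: "a \<le> u t" "u t \<le> b" if "t \<in> {0..1}" for t
  proof -
    have "u t = a + t * (b - a)" "u t = b - (1 - t) * (b - a)"
      by (simp_all add: u_def algebra_simps)
    moreover have "0 \<le> t * (b - a)" "0 \<le> (1 - t) * (b - a)"
      using that ab by simp_all
    ultimately show "a \<le> u t" "u t \<le> b" by linarith+
  qed
  have u0: "0 < u t" if "t \<in> {0..1}" for t
    using u[OF that] a by simp
  have x_in: "a * b / u t \<in> {a..b}" if "t \<in> {0..1}" for t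
    using u[OF that] u0[OF that] a ab by (simp add: field_simps)
  have der_x: "((\<lambda>t. a * b / u t) has_real_derivative - (a * b * (b - a) / (u t)\<^sup>2)) (at t within {0..1})"
    if "t \<in> {0..1}" for t
  proof -
    have "(u has_real_derivative b - a) (at t within {0..1})"
      unfolding u_def by (auto intro!: derivative_eq_intros)
    from DERIV_cmult[OF DERIV_inverse_fun[OF this], of "a * b"] u0[OF that] show ?thesis
      by (simp add: power2_eq_square divide_inverse mult_ac)
  qed
  have der_f: "((\<lambda>t. f (a * b / u t)) has_real_derivative
      f' (a * b / u t) * - (a * b * (b - a) / (u t)\<^sup>2)) (at t within {0..1})" if "t \<in> {0..1}" for t
    using DERIV_chain2[OF f[OF x_in[OF that]] der_x[OF that]] .
  have cont_f: "continuous_on {a..b} f"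
    using f by (meson DERIV_continuous_on DERIV_subset top_greatest)
  have u_ends: "u 0 = a" "u 1 = b"
    by (simp_all add: u_def)
  have parts: "((\<lambda>t. - f (a * b / u t) + (1 / 2 - t) * (f' (a * b / u t) * - (a * b * (b - a) / (u t)\<^sup>2)))
      has_integral ((1 / 2 - 1) * f (a * b / u 1) - (1 / 2 - 0) * f (a * b / u 0))) {0..1}"
    by (rule fundamental_theorem_of_calculus)
      (auto intro!: derivative_eq_intros der_f simp flip: has_real_derivative_iff_has_vector_derivative)
  have subst: "((\<lambda>t. (- (a * b * (b - a) / (u t)\<^sup>2)) *\<^sub>R (f (a * b / u t) / (a * b / u t)\<^sup>2))
      has_integral (integral {a * b / u 0..a * b / u 1} (\<lambda>x. f x / x\<^sup>2)
        - integral {a * b / u 1..a * b / u 0} (\<lambda>x. f x / x\<^sup>2))) {0..1}"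
  proof (rule has_integral_substitution_general[of "{}" 0 1 "\<lambda>t. a * b / u t" a b])
    show "continuous_on {a..b} (\<lambda>x. f x / x\<^sup>2)"
      using a by (intro continuous_intros cont_f) auto
    show "continuous_on {0..1} (\<lambda>t. a * b / u t)"
      using der_x by (rule DERIV_continuous_on)
  qed (use x_in der_x in auto)
  have "((\<lambda>t. - (a * b / (b - a)) * ((- (a * b * (b - a) / (u t)\<^sup>2)) *\<^sub>R (f (a * b / u t) / (a * b / u t)\<^sup>2)))
      has_integral (- (a * b / (b - a)) * (0 - integral {a..b} (\<lambda>x. f x / x\<^sup>2)))) {0..1}"
    using has_integral_mult_right[OF subst, of "- (a * b / (b - a))"] a ab by (simp add: u_ends)
  moreover have "- (a * b / (b - a)) * ((- (a * b * (b - a) / (u t)\<^sup>2)) *\<^sub>R (f (a * b / u t) / (a * b / u t)\<^sup>2))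
      = f (a * b / u t)" if "t \<in> {0..1}" for t
    using u0[OF that] a ab by (simp add: power2_eq_square field_simps)
  ultimately have mean: "((\<lambda>t. f (a * b / u t)) has_integral
      (a * b / (b - a) * integral {a..b} (\<lambda>x. f x / x\<^sup>2))) {0..1}"
    by (subst has_integral_cong[where g = "\<lambda>t. - (a * b / (b - a)) *
      ((- (a * b * (b - a) / (u t)\<^sup>2)) *\<^sub>R (f (a * b / u t) / (a * b / u t)\<^sup>2))"]) auto
  have "((\<lambda>t. a * b * (b - a) / 2 * ((1 - 2 * t) * (f' (a * b / u t) / (u t)\<^sup>2))) has_integral
      - ((1 / 2 - 1) * f (a * b / u 1) - (1 / 2 - 0) * f (a * b / u 0)
        + a * b / (b - a) * integral {a..b} (\<lambda>x. f x / x\<^sup>2))) {0..1}"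
    by (rule has_integral_eq[OF _ has_integral_neg[OF has_integral_add[OF parts mean]]])
      (use u0 in \<open>simp add: field_simps\<close>)
  moreover have "- ((1 / 2 - 1) * f (a * b / u 1) - (1 / 2 - 0) * f (a * b / u 0)
        + a * b / (b - a) * integral {a..b} (\<lambda>x. f x / x\<^sup>2))
      = (f a + f b) / 2 - a * b / (b - a) * integral {a..b} (\<lambda>x. f x / x\<^sup>2)"
    using a ab by (simp add: u_ends field_simps)
  ultimately show ?thesis
    by (simp only: u_def)
qed

section \<open>The hypergeometric coefficients as weighted integrals\<close>

lemma Beta_mult_hyp2F1:
  assumes "0 < B" "B < C"
  shows "Beta B (C - B) * hyp2F1 A B C z =
    integral {0..1} (\<lambda>t. t powr (B - 1) * (1 - t) powr (C - B - 1) * (1 - z * t) powr (- A))"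
proof -
  have "Beta B (C - B) > 0"
    using assms by (simp add: Beta_def)
  then show ?thesis by (simp add: hyp2F1_def)
qed

lemma has_integral_reflect_scale:
  fixes h :: "real \<Rightarrow> real"
  assumes c: "0 < c" and h: "continuous_on {0..c} h"
  shows "((\<lambda>s. c * h (c * (1 - s))) has_integral integral {0..c} h) {0..1}"
proof -
  have "((\<lambda>s. (- c) *\<^sub>R h (c * (1 - s))) has_integral
      (integral {c * (1 - 0)..c * (1 - 1)} h - integral {c * (1 - 1)..c * (1 - 0)} h)) {0..1}"
  proof (rule has_integral_substitution_general[of "{}" 0 1 "\<lambda>s. c * (1 - s)" 0 c])
    show "(\<lambda>s. c * (1 - s)) ` {0..1} \<subseteq> {0..c}"
      using c by (auto simp: mult_le_cancel_left1)
  qed (auto intro!: h continuous_intros derivative_eq_intros)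
  from has_integral_neg[OF this] c show ?thesis by simp
qed

lemma continuous_on_nn_power:
  assumes "0 \<le> \<alpha>"
  shows "continuous_on {0..1} (\<lambda>t. nn_power t \<alpha>)"
proof (cases "\<alpha> = 0")
  case False
  with assms have "0 < \<alpha>" by simp
  then have "continuous_on {0..1} (\<lambda>t::real. t powr \<alpha>)"
    by (intro continuous_on_powr' continuous_on_id continuous_on_const) auto
  with False show ?thesis by (simp add: nn_power_def)
qed (simp add: nn_power_def)

text \<open>
  Split \<open>\<bar>1 - 2 * t\<bar>\<close> as \<open>t - (1 - t) + 2 * max 0 (1 - 2 * t)\<close>. Reflecting \<open>t = 1 - s\<close> makes the
  first two pieces Euler integrals, since \<open>u t = b * (1 - (1 - a / b) * s)\<close>. The last piece lives on
  \<open>0 \<le> t \<le> 1 / 2\<close>, where \<open>t = (1 - s) / 2\<close> gives \<open>u t = (a + b) / 2 * (1 - (1 - 2 * a / (a + b)) * s)\<close>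
  and hence the Euler integral with \<open>a + b\<close>.
\<close>

lemma lam_has_integral:
  assumes a: "0 < a" and ab: "a < b" and \<alpha>: "0 \<le> \<alpha>"
  shows "((\<lambda>t. \<bar>1 - 2 * t\<bar> * (nn_power t \<alpha> * (t * b + (1 - t) * a) powr (- (2 * q))))
    has_integral lam \<alpha> q a b) {0..1}"
proof -
  define h where "h = (\<lambda>t. nn_power t \<alpha> * (t * b + (1 - t) * a) powr (- (2 * q)))"
  have u0: "0 < t * b + (1 - t) * a" if "t \<in> {0..1}" for t
  proof -
    have "t * b + (1 - t) * a = a + t * (b - a)" by (simp add: algebra_simps)
    with that a ab show ?thesis by (simp add: add_pos_nonneg)
  qed
  have cont_h: "continuous_on {0..1} h"
    unfolding h_def using u0 by (intro continuous_intros continuous_on_nn_power \<alpha>) force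
  have cont_h_half: "continuous_on {0..1/2} h"
    by (rule continuous_on_subset[OF cont_h]) auto
  have outer: "h (1 - s) = (1 - s) powr \<alpha> * (1 - (1 - a / b) * s) powr (- (2 * q)) / b powr (2 * q)"
    if "0 < s" "s < 1" for s
  proof -
    have "(1 - s) * b + (1 - (1 - s)) * a = b * (1 - (1 - a / b) * s)"
      using a ab by (simp add: field_simps)
    then have "((1 - s) * b + (1 - (1 - s)) * a) powr (- (2 * q))
        = b powr (- (2 * q)) * (1 - (1 - a / b) * s) powr (- (2 * q))"
      by (simp only: powr_mult)
    then show ?thesis
      unfolding h_def using that by (simp add: nn_power_def powr_minus[of b] divide_inverse)
  qed
  have inner: "h (1 / 2 * (1 - s)) =
      2 powr (2 * q - \<alpha>) / (a + b) powr (2 * q) *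
        ((1 - s) powr \<alpha> * (1 - (1 - 2 * a / (a + b)) * s) powr (- (2 * q)))"
    if "0 < s" "s < 1" for s
  proof -
    have u_eq: "1 / 2 * (1 - s) * b + (1 - 1 / 2 * (1 - s)) * a
        = (a + b) / 2 * (1 - (1 - 2 * a / (a + b)) * s)"
      using a ab by (simp add: field_simps)
    have "(1 / 2 * (1 - s) * b + (1 - 1 / 2 * (1 - s)) * a) powr (- (2 * q))
        = ((a + b) / 2) powr (- (2 * q)) * (1 - (1 - 2 * a / (a + b)) * s) powr (- (2 * q))"
      unfolding u_eq by (simp only: powr_mult)
    also have "((a + b) / 2) powr (- (2 * q)) = 2 powr (2 * q) / (a + b) powr (2 * q)"
      using a ab by (simp add: powr_minus powr_divide)
    finally have 1: "(1 / 2 * (1 - s) * b + (1 - 1 / 2 * (1 - s)) * a) powr (- (2 * q)) = \<dots> *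
        (1 - (1 - 2 * a / (a + b)) * s) powr (- (2 * q))" .
    have 2: "nn_power (1 / 2 * (1 - s)) \<alpha> = 2 powr (- \<alpha>) * (1 - s) powr \<alpha>"
      using that by (simp add: nn_power_def powr_divide powr_minus field_simps)
    have 3: "2 powr (2 * q - \<alpha>) = 2 powr (2 * q) * (2::real) powr (- \<alpha>)"
      by (simp add: powr_diff powr_minus field_simps)
    show ?thesis
      unfolding h_def 1 2 3 by simp
  qed
  have term1: "integral {0..1} (\<lambda>t. t * h t)
      = Beta 1 (\<alpha> + 2) / b powr (2 * q) * hyp2F1 (2 * q) 1 (\<alpha> + 3) (1 - a / b)"
  proof -
    have "integral {0..1} (\<lambda>t. t * h t) = integral {0..1} (\<lambda>s. (1 - s) * h (1 - s))"
      using integral_unique[OF has_integral_reflect_scale[of 1 "\<lambda>t. t * h t"]]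
      by (simp add: cont_h continuous_intros)
    also have "\<dots> = integral {0..1} (\<lambda>s. 1 / b powr (2 * q) * (s powr (1 - 1) * (1 - s) powr (\<alpha> + 3 - 1 - 1)
        * (1 - (1 - a / b) * s) powr (- (2 * q))))"
      by (rule integral_spike[of "{0, 1}"]) (auto simp: outer powr_add)
    also have "\<dots> = 1 / b powr (2 * q) * (Beta 1 (\<alpha> + 3 - 1) * hyp2F1 (2 * q) 1 (\<alpha> + 3) (1 - a / b))"
      using \<alpha> by (subst Beta_mult_hyp2F1) auto
    finally show ?thesis by (simp add: add.commute)
  qed
  have term2: "integral {0..1} (\<lambda>t. (1 - t) * h t)
      = Beta 2 (\<alpha> + 1) / b powr (2 * q) * hyp2F1 (2 * q) 2 (\<alpha> + 3) (1 - a / b)"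
  proof -
    have "integral {0..1} (\<lambda>t. (1 - t) * h t) = integral {0..1} (\<lambda>s. s * h (1 - s))"
      using integral_unique[OF has_integral_reflect_scale[of 1 "\<lambda>t. (1 - t) * h t"]]
      by (simp add: cont_h continuous_intros)
    also have "\<dots> = integral {0..1} (\<lambda>s. 1 / b powr (2 * q) * (s powr (2 - 1) * (1 - s) powr (\<alpha> + 3 - 2 - 1)
        * (1 - (1 - a / b) * s) powr (- (2 * q))))"
      by (rule integral_spike[of "{0, 1}"]) (auto simp: outer)
    also have "\<dots> = 1 / b powr (2 * q) * (Beta 2 (\<alpha> + 3 - 2) * hyp2F1 (2 * q) 2 (\<alpha> + 3) (1 - a / b))"
      using \<alpha> by (subst Beta_mult_hyp2F1) auto
    finally show ?thesis by (simp add: add.commute)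
  qed
  have term3: "integral {0..1/2} (\<lambda>t. 2 * (1 - 2 * t) * h t)
      = 2 powr (2 * q - \<alpha>) * Beta 2 (\<alpha> + 1) / (a + b) powr (2 * q)
         * hyp2F1 (2 * q) 2 (\<alpha> + 3) (1 - 2 * a / (a + b))"
  proof -
    have "continuous_on {0..1/2} (\<lambda>t. 2 * (1 - 2 * t) * h t)"
      by (intro continuous_intros cont_h_half)
    then have "((\<lambda>s. 1 / 2 * (2 * (1 - 2 * (1 / 2 * (1 - s))) * h (1 / 2 * (1 - s)))) has_integral
        integral {0..1/2} (\<lambda>t. 2 * (1 - 2 * t) * h t)) {0..1}"
      by (intro has_integral_reflect_scale) simp
    moreover have "1 / 2 * (2 * (1 - 2 * (1 / 2 * (1 - s))) * x) = s * x" for s x :: real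
      by (simp add: field_simps)
    ultimately have "integral {0..1/2} (\<lambda>t. 2 * (1 - 2 * t) * h t)
        = integral {0..1} (\<lambda>s. s * h (1 / 2 * (1 - s)))"
      by (simp only: integral_unique)
    also have "\<dots> = integral {0..1} (\<lambda>s. 2 powr (2 * q - \<alpha>) / (a + b) powr (2 * q) *
        (s powr (2 - 1) * (1 - s) powr (\<alpha> + 3 - 2 - 1) * (1 - (1 - 2 * a / (a + b)) * s) powr (- (2 * q))))"
    proof (rule integral_spike[of "{0, 1}"])
      fix s :: real assume "s \<in> {0..1} - {0, 1}"
      then have s: "0 < s" "s < 1" by auto
      then show "2 powr (2 * q - \<alpha>) / (a + b) powr (2 * q) *
          (s powr (2 - 1) * (1 - s) powr (\<alpha> + 3 - 2 - 1) * (1 - (1 - 2 * a / (a + b)) * s) powr (- (2 * q)))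
          = s * h (1 / 2 * (1 - s))"
        unfolding inner[OF s] by simp
    qed simp
    also have "\<dots> = 2 powr (2 * q - \<alpha>) / (a + b) powr (2 * q) *
        (Beta 2 (\<alpha> + 3 - 2) * hyp2F1 (2 * q) 2 (\<alpha> + 3) (1 - 2 * a / (a + b)))"
      using \<alpha> by (subst Beta_mult_hyp2F1) auto
    finally show ?thesis by (simp add: add.commute)
  qed
  have int_lin: "(\<lambda>t. t * h t) integrable_on {0..1}" "(\<lambda>t. (1 - t) * h t) integrable_on {0..1}"
    by (intro integrable_continuous_real continuous_intros cont_h)+
  have "(\<lambda>t. 2 * (1 - 2 * t) * h t) integrable_on {0..1/2}"
    by (intro integrable_continuous_real continuous_intros cont_h_half)
  then have "((\<lambda>t. if t \<in> {0..1/2} then 2 * (1 - 2 * t) * h t else 0) has_integral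
      integral {0..1/2} (\<lambda>t. 2 * (1 - 2 * t) * h t)) {0..1}"
    by (subst has_integral_restrict) (auto simp: has_integral_iff)
  from has_integral_add[OF has_integral_diff[OF int_lin[THEN integrable_integral]] this]
  have "((\<lambda>t. t * h t - (1 - t) * h t + (if t \<in> {0..1/2} then 2 * (1 - 2 * t) * h t else 0))
      has_integral lam \<alpha> q a b) {0..1}"
    unfolding term1 term2 term3 lam_def .
  moreover have "t * h t - (1 - t) * h t + (if t \<in> {0..1/2} then 2 * (1 - 2 * t) * h t else 0)
      = \<bar>1 - 2 * t\<bar> * h t" if "t \<in> {0..1}" for t
    using that by (auto simp: algebra_simps)
  ultimately have "((\<lambda>t. \<bar>1 - 2 * t\<bar> * h t) has_integral lam \<alpha> q a b) {0..1}"
    by (rule has_integral_eq[rotated])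
  then show ?thesis by (simp add: h_def)
qed

lemma abs_one_minus_twice_has_integral:
  "((\<lambda>t::real. \<bar>1 - 2 * t\<bar>) has_integral (1 / 2)) {0..1}"
proof -
  have "((\<lambda>t::real. 1 - 2 * t) has_integral ((1 / 2 - (1 / 2)\<^sup>2) - (0 - 0\<^sup>2))) {0..1/2}"
    by (rule fundamental_theorem_of_calculus)
      (auto intro!: derivative_eq_intros simp flip: has_real_derivative_iff_has_vector_derivative)
  then have left: "((\<lambda>t::real. \<bar>1 - 2 * t\<bar>) has_integral (1 / 4)) {0..1/2}"
    by (subst has_integral_cong[where g = "\<lambda>t. 1 - 2 * t"]) (auto simp: power2_eq_square)
  have "((\<lambda>t::real. 2 * t - 1) has_integral ((1\<^sup>2 - 1) - ((1 / 2)\<^sup>2 - 1 / 2))) {1/2..1}"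
    by (rule fundamental_theorem_of_calculus)
      (auto intro!: derivative_eq_intros simp flip: has_real_derivative_iff_has_vector_derivative)
  then have right: "((\<lambda>t::real. \<bar>1 - 2 * t\<bar>) has_integral (1 / 4)) {1/2..1}"
    by (subst has_integral_cong[where g = "\<lambda>t. 2 * t - 1"]) (auto simp: power2_eq_square)
  from has_integral_combine[OF _ _ left right] show ?thesis by simp
qed

section \<open>The trapezoid inequality\<close>

theorem theorem5:
  fixes I :: "real set" and f :: "real \<Rightarrow> real" and m a b \<alpha> q :: real
  assumes "is_interval I" and "I \<subseteq> {0<..}"
    and "f differentiable_on interior I"
    and "0 < m" and "m \<le> 1"
    and "a \<in> interior I" and "b / m \<in> interior I" and "a < b"
    and "deriv f absolutely_integrable_on {a..b}"
    and "0 \<le> \<alpha>" and "\<alpha> \<le> 1" and "1 \<le> q"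
    and "harmonically_convex_on \<alpha> m {a..b / m} (\<lambda>x. \<bar>deriv f x\<bar> powr q)"
  shows "\<bar>(f a + f b) / 2 - a * b / (b - a) * integral {a..b} (\<lambda>x. f x / x\<^sup>2)\<bar>
    \<le> a * b * (b - a) / 2 powr (2 - 1 / q)
        * (lam \<alpha> q a b * \<bar>deriv f a\<bar> powr q
            + m * mu \<alpha> q a b * \<bar>deriv f (b / m)\<bar> powr q) powr (1 / q)"
proof -
  note m = assms(4,5) and ab = assms(8) and \<alpha> = assms(10) and q = assms(12)
  have a: "0 < a"
    using assms(2,6) interior_subset by fastforce
  have b_le: "b \<le> b / m"
    using a ab m by (simp add: field_simps)
  have "convex (interior I)"
    using assms(1) by (simp add: convex_interior is_interval_convex)
  then have "closed_segment a (b / m) \<subseteq> interior I"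
    using assms(6,7) by (simp add: closed_segment_subset)
  then have "{a..b / m} \<subseteq> interior I"
    using ab b_le by (simp add: closed_segment_eq_real_ivl)
  then have sub: "{a..b} \<subseteq> interior I"
    using b_le by auto
  have der: "(f has_real_derivative deriv f x) (at x)" if "x \<in> {a..b}" for x
  proof -
    have "x \<in> interior I" using sub that by auto
    then have "f differentiable (at x)"
      using assms(3) by (metis at_within_open differentiable_on_def open_interior)
    then show ?thesis
      by (simp add: DERIV_deriv_iff_real_differentiable)
  qed
  define u where "u = (\<lambda>t. t * b + (1 - t) * a)"
  define A where "A = \<bar>deriv f a\<bar> powr q"
  define C where "C = \<bar>deriv f (b / m)\<bar> powr q"
  define g where "g = (\<lambda>t. deriv f (a * b / u t) / (u t)\<^sup>2)"
  define G where "G = (\<lambda>t. u t powr (- (2 * q)) * (nn_power t \<alpha> * A + m * (1 - nn_power t \<alpha>) * C))"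
  define E where "E = (f a + f b) / 2 - a * b / (b - a) * integral {a..b} (\<lambda>x. f x / x\<^sup>2)"
  define c where "c = a * b * (b - a) / 2"
  have c: "0 < c"
    using a ab by (simp add: c_def)
  have "((\<lambda>t. c * ((1 - 2 * t) * g t)) has_integral E) {0..1}"
    using harmonic_trapezoid_identity[OF a ab der] by (simp add: u_def g_def E_def c_def)
  from has_integral_mult_right[OF this, of "1 / c"]
  have "((\<lambda>t. (1 - 2 * t) * g t) has_integral E / c) {0..1}"
    using c by simp
  (* the sign of the kernel goes into the integrand, since the power mean needs a nonnegative weight *)
  moreover have "(1 - 2 * t) * g t = \<bar>1 - 2 * t\<bar> * (sgn (1 - 2 * t) * g t)" for t
    by (simp add: abs_mult_sgn flip: mult.assoc)
  ultimately have X: "((\<lambda>t. \<bar>1 - 2 * t\<bar> * (sgn (1 - 2 * t) * g t)) has_integral E / c) {0..1}"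
    by simp
  have g_le: "\<bar>g t\<bar> powr q \<le> G t" if t: "t \<in> {0..1}" for t
  proof -
    have "u t = a + t * (b - a)" "u t = b - (1 - t) * (b - a)"
      by (simp_all add: u_def algebra_simps)
    moreover have "0 \<le> t * (b - a)" "0 \<le> (1 - t) * (b - a)"
      using t ab by simp_all
    ultimately have u: "a \<le> u t" "u t \<le> b" by linarith+
    then have u0: "0 < u t" using a by simp
    have point: "m * a * (b / m) / (m * t * (b / m) + (1 - t) * a) = a * b / u t"
      using m by (simp add: u_def)
    have "a \<le> a * b / u t" "a * b / u t \<le> b"
      using u u0 a ab by (simp_all add: field_simps)
    then have "a * b / u t \<in> {a..b / m}"
      using b_le by simp
    moreover have "a \<in> {a..b / m}" "b / m \<in> {a..b / m}"
      using ab b_le by auto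
    ultimately have conv: "\<bar>deriv f (a * b / u t)\<bar> powr q \<le> nn_power t \<alpha> * A + m * (1 - nn_power t \<alpha>) * C"
      using assms(13) t point unfolding harmonically_convex_on_def A_def C_def by metis
    have "\<bar>g t\<bar> = \<bar>deriv f (a * b / u t)\<bar> / u t powr 2"
      using u0 by (simp add: g_def)
    then have "\<bar>g t\<bar> powr q = u t powr (- (2 * q)) * \<bar>deriv f (a * b / u t)\<bar> powr q"
      by (simp add: powr_divide powr_powr powr_minus field_simps)
    also have "\<dots> \<le> G t"
      unfolding G_def by (intro mult_left_mono conv) simp
    finally show ?thesis .
  qed
  have S: "((\<lambda>t. \<bar>1 - 2 * t\<bar> * G t) has_integral (lam \<alpha> q a b * A + m * mu \<alpha> q a b * C)) {0..1}"
  proof -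
    note L = lam_has_integral[OF a ab \<alpha>, of q] and L0 = lam_has_integral[OF a ab order_refl, of q]
    have "((\<lambda>t. \<bar>1 - 2 * t\<bar> * (nn_power t \<alpha> * u t powr (- (2 * q))) * A
          + m * C * (\<bar>1 - 2 * t\<bar> * (nn_power t 0 * u t powr (- (2 * q)))
                      - \<bar>1 - 2 * t\<bar> * (nn_power t \<alpha> * u t powr (- (2 * q)))))
        has_integral (lam \<alpha> q a b * A + m * C * (lam 0 q a b - lam \<alpha> q a b))) {0..1}"
      unfolding u_def
      by (intro has_integral_add has_integral_mult_right has_integral_mult_left has_integral_diff L L0)
    then show ?thesis
      by (simp add: G_def mu_def nn_power_def[of _ 0] algebra_simps)
  qed
  have "\<bar>E / c\<bar> \<le> (1 / 2) powr (1 - 1 / q) * (lam \<alpha> q a b * A + m * mu \<alpha> q a b * C) powr (1 / q)"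
  proof (rule weighted_power_mean_le[OF q _ _ X abs_one_minus_twice_has_integral _ S])
    fix t :: real assume t: "t \<in> {0..1}"
    have "\<bar>sgn (1 - 2 * t) * g t\<bar> \<le> \<bar>g t\<bar>"
      by (simp add: abs_mult abs_sgn_eq)
    then have "\<bar>sgn (1 - 2 * t) * g t\<bar> powr q \<le> \<bar>g t\<bar> powr q"
      using q by (intro powr_mono2) auto
    with g_le[OF t] show "\<bar>sgn (1 - 2 * t) * g t\<bar> powr q \<le> G t"
      by simp
  qed auto
  then have "\<bar>E\<bar> \<le> c * (1 / 2) powr (1 - 1 / q) * (lam \<alpha> q a b * A + m * mu \<alpha> q a b * C) powr (1 / q)"
    using c by (simp add: abs_divide field_simps)
  also have "c * (1 / 2) powr (1 - 1 / q) = a * b * (b - a) / 2 powr (2 - 1 / q)"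
  proof -
    have "2 powr (2 - 1 / q) = 2 * (2::real) powr (1 - 1 / q)"
      using powr_add[of "2::real" 1 "1 - 1 / q"] by simp
    then show ?thesis
      by (simp add: c_def powr_divide)
  qed
  finally show ?thesis
    unfolding E_def A_def C_def .
qed

end
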